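(* Let $\mathbb{M}$ be a compact Riemannian manifold that is a homogeneous space for a Lie group $\mathcal{G}$. Let $\mu$ be the $\mathcal{G}$-invariant Riemannian measure on $\mathbb{M}$, let $\Pi=\operatorname{span}\{\psi_1,\dots,\psi_m\}$ with $\psi_1,\dots,\psi_m$ linearly independent continuous real functions on $\mathbb{M}$, and let $\kappa:\mathbb{M}\times\mathbb{M}\to\mathbb{R}$ be a continuous kernel that is conditionally positive definite with respect to $\Pi$ and $\mathcal{G}$-invariant: $\kappa(\gamma x,\gamma y)=\kappa(x,y)$ for all $x,y\in\mathbb{M}$, $\gamma\in\mathcal{G}$. Let $X\subset\mathbb{M}$ be a finite set with $N$ elements on which $\Pi$ is unisolvent. Let $A=(\kappa(\xi,\eta))_{\xi,\eta\in X}$, let $\Psi$ be the $N\times m$ matrix with columns $\psi_k|_X$, let $\mathbf{1}\in\mathbb{R}^N$ be the vector of ones, $J_0=\int_{\mathbb{M}}\kappa(x,y)\,d\mu(x)$ (independent of $y$), $J_k=\int_{\mathbb{M}}\psi_k\,d\mu$ for $k=1,\dots,m$, and $J=(J_1,\dots,J_m)^T$. Suppose that $c$ and $d$ are the $N\times1$ and $m\times1$ column vectors that uniquely solve the $(N+m)\times(N+m)$ system $$Ac+\Psi d=J_0\mathbf{1},\qquad \Psi^Tc=J.$$ If $s\in V_X$, then $$\int_{\mathbb{M}}s(x)\,d\mu(x)=c^Ts|_X=\sum_{\xi\in X}c_\xi s(\xi).$$ In addition, if $\chi_\xi\in V_X$ is the Lagrange function centered at $\xi$, then $$c_\xi=\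int_{\mathbb{M}}\chi_\xi(x)\,d\mu(x)\quad\text{and}\quad|c_\xi|\le\|\chi_\xi\|_{L_1(\mathbb{M})}.$$
   Context: Homogeneous space: $\mathcal{G}$ acts transitively on $\mathbb{M}$; invariance of $\mu$ means $\int f(\gamma x)\,d\mu(x)=\int f(x)\,d\mu(x)$ for all $f\in L_1(\mathbb{M})$, $\gamma\in\mathcal{G}$. $\Pi$ is unisolvent on $X$ if the only $\psi\in\Pi$ with $\psi|_X=0$ is $\psi\equiv0$. The kernel $\kappa$ is conditionally positive definite with respect to $\Pi$ if for every finite $X$ on which $\Pi$ is unisolvent and every nonzero $(a_\xi)_{\xi\in X}$ with $\sum_\xi a_\xi\psi_k(\xi)=0$, $k=1,\dots,m$, one has $\sum_{\xi,\eta\in X}a_\xi a_\eta\kappa(\xi,\eta)>0$. $V_X$ is the space of functions $s=\sum_{\xi\in X}a_\xi\kappa(\cdot,\xi)+\sum_{k=1}^mb_k\psi_k$ with $\sum_{\xi\in X}a_\xi\psi_k(\xi)=0$ for $k=1,\dots,m$. The Lagrange function $\chi_\xi$ is the unique element of $V_X$ with $\chi_\xi(\eta)=\delta_{\xi,\eta}$ for all $\eta\in X$.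
   Formalization: The kernel κ is additionally assumed symmetric, κ(x,y)=κ(y,x); without this the claim fails, e.g. on the circle with Π the constants and κ(x,y)=e(x−y)+sin(x−y), e even and strictly positive definite, X two points that are not antipodal. *)

theory Defs
  imports "HOL-Analysis.Analysis" "HOL-Algebra.Group_Action" "Jordan_Normal_Form.Determinant"
begin

section \<open>Smooth functions on open subsets of Euclidean space\<close>

text \<open>The coordinate space of dimension \<open>n\<close> is \<open>topspace (Euclidean_space n)\<close>, the functions
  \<open>nat \<Rightarrow> real\<close> that vanish from index \<open>n\<close> on. Its topology is the one induced by the
  topology of the type \<open>nat \<Rightarrow> real\<close>, so \<open>continuous_on\<close> and \<open>homeomorphism\<close> apply to it.
  The dimension is a natural number; dimension zero is included.\<close>

definition partial_deriv :: "nat \<Rightarrow> ((nat \<Rightarrow> real) \<Rightarrow> real) \<Rightarrow> (nat \<Rightarrow> real) \<Rightarrow> real" where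
  "partial_deriv i f x = deriv (\<lambda>t. f (x(i := t))) (x i)"

text \<open>\<open>Ck_on k n W f\<close>: all partial derivatives of order at most \<open>k\<close> of \<open>f\<close> exist and are
  continuous on \<open>W\<close>, for \<open>W\<close> open in \<open>Euclidean_space n\<close>. Values of \<open>f\<close> off \<open>W\<close> are
  irrelevant.\<close>

primrec Ck_on :: "nat \<Rightarrow> nat \<Rightarrow> (nat \<Rightarrow> real) set \<Rightarrow> ((nat \<Rightarrow> real) \<Rightarrow> real) \<Rightarrow> bool" where
  "Ck_on 0 n W f \<longleftrightarrow> continuous_on W f"
| "Ck_on (Suc k) n W f \<longleftrightarrow> continuous_on W f \<and>
     (\<forall>i<n. (\<forall>x\<in>W. (\<lambda>t. f (x(i := t))) field_differentiable at (x i)) \<and>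
            Ck_on k n W (partial_deriv i f))"

definition smooth_on :: "nat \<Rightarrow> (nat \<Rightarrow> real) set \<Rightarrow> ((nat \<Rightarrow> real) \<Rightarrow> real) \<Rightarrow> bool" where
  "smooth_on n W f \<longleftrightarrow> (\<forall>k. Ck_on k n W f)"

section \<open>Smooth manifolds and Lie groups\<close>

text \<open>The underlying space of a manifold is a whole type of class \<open>t2_space\<close> and
  \<open>second_countable_topology\<close>. A chart is a pair of its domain and its coordinate map; the
  values of the coordinate map outside the domain are irrelevant.\<close>

type_synonym 'a chart = "'a set \<times> ('a \<Rightarrow> nat \<Rightarrow> real)"

definition is_chart :: "nat \<Rightarrow> 'a::topological_space chart \<Rightarrow> bool" where
  "is_chart n = (\<lambda>(U, \<phi>). open U \<and> openin (Euclidean_space n) (\<phi> ` U) \<and>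
     homeomorphism U (\<phi> ` U) \<phi> (inv_into U \<phi>))"

definition smooth_atlas :: "nat \<Rightarrow> 'a::topological_space chart set \<Rightarrow> bool" where
  "smooth_atlas n \<A> \<longleftrightarrow> (\<forall>C\<in>\<A>. is_chart n C) \<and> (\<Union>(U, \<phi>)\<in>\<A>. U) = UNIV \<and>
     (\<forall>(U, \<phi>)\<in>\<A>. \<forall>(V, \<psi>)\<in>\<A>. \<forall>j<n.
        smooth_on n (\<phi> ` (U \<inter> V)) (\<lambda>x. \<psi> (inv_into U \<phi> x) j))"

definition smooth_map ::
  "nat \<Rightarrow> 'a::topological_space chart set \<Rightarrow> nat \<Rightarrow> 'b::topological_space chart set
    \<Rightarrow> ('a \<Rightarrow> 'b) \<Rightarrow> bool" where
  "smooth_map n \<A> k \<B> f \<longleftrightarrow> continuous_on UNIV f \<and>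
     (\<forall>(U, \<phi>)\<in>\<A>. \<forall>(V, \<psi>)\<in>\<B>. \<forall>j<k.
        smooth_on n (\<phi> ` (U \<inter> f -` V)) (\<lambda>x. \<psi> (f (inv_into U \<phi> x)) j))"

text \<open>The product charts have coordinates \<open>(x\<^sub>0, \<dots>, x\<^bsub>n-1\<^esub>, y\<^sub>0, \<dots>, y\<^bsub>k-1\<^esub>)\<close>.\<close>

definition product_atlas :: "nat \<Rightarrow> 'a chart set \<Rightarrow> 'b chart set \<Rightarrow> ('a \<times> 'b) chart set" where
  "product_atlas n \<A> \<B> =
     {(U \<times> V, \<lambda>(p, q) i. if i < n then \<phi> p i else \<psi> q (i - n)) | U \<phi> V \<psi>.
        (U, \<phi>) \<in> \<A> \<and> (V, \<psi>) \<in> \<B>}"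

definition lie_group ::
  "nat \<Rightarrow> 'g::{t2_space, second_countable_topology} chart set \<Rightarrow> 'g monoid \<Rightarrow> bool" where
  "lie_group p \<B> G \<longleftrightarrow> group G \<and> carrier G = UNIV \<and> smooth_atlas p \<B> \<and>
     smooth_map (p + p) (product_atlas p \<B> \<B>) p \<B> (\<lambda>(x, y). x \<otimes>\<^bsub>G\<^esub> y) \<and>
     smooth_map p \<B> p \<B> (\<lambda>x. inv\<^bsub>G\<^esub> x)"

text \<open>The manifold with atlas \<open>\<A>\<close> is a homogeneous space for the Lie group \<open>G\<close>: the action is
  smooth and transitive.\<close>

definition homogeneous_space ::
  "nat \<Rightarrow> 'g::{t2_space, second_countable_topology} chart set \<Rightarrow> 'g monoid \<Rightarrow>
   nat \<Rightarrow> 'a::{t2_space, second_countable_topology} chart set \<Rightarrow> ('g \<Rightarrow> 'a \<Rightarrow> 'a) \<Rightarrow> bool" where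
  "homogeneous_space p \<B> G n \<A> act \<longleftrightarrow> lie_group p \<B> G \<and> smooth_atlas n \<A> \<and>
     transitive_action G UNIV act \<and>
     smooth_map (p + n) (product_atlas p \<B> \<A>) n \<A> (\<lambda>(\<gamma>, x). act \<gamma> x)"

section \<open>Riemannian metrics and Riemannian measure\<close>

text \<open>A Riemannian metric is given by its components \<open>g C x i j\<close> in every chart \<open>C\<close> of the atlas,
  at the coordinates \<open>x\<close> of a point. They form a smooth field of symmetric positive definite
  matrices and transform as a covariant 2-tensor.\<close>

definition riemannian_metric ::
  "nat \<Rightarrow> 'a::topological_space chart set \<Rightarrow>
    ('a chart \<Rightarrow> (nat \<Rightarrow> real) \<Rightarrow> nat \<Rightarrow> nat \<Rightarrow> real) \<Rightarrow> bool" where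
  "riemannian_metric n \<A> g \<longleftrightarrow>
     (\<forall>(U, \<phi>)\<in>\<A>.
        (\<forall>i<n. \<forall>j<n. smooth_on n (\<phi> ` U) (\<lambda>x. g (U, \<phi>) x i j)) \<and>
        (\<forall>x\<in>\<phi> ` U. \<forall>i<n. \<forall>j<n. g (U, \<phi>) x i j = g (U, \<phi>) x j i) \<and>
        (\<forall>x\<in>\<phi> ` U. \<forall>v :: nat \<Rightarrow> real. (\<exists>i<n. v i \<noteq> 0) \<longrightarrow>
           (\<Sum>i<n. \<Sum>j<n. g (U, \<phi>) x i j * v i * v j) > 0)) \<and>
     (\<forall>(U, \<phi>)\<in>\<A>. \<forall>(V, \<psi>)\<in>\<A>. \<forall>q\<in>U \<inter> V. \<forall>i<n. \<forall>j<n.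
        g (U, \<phi>) (\<phi> q) i j =
          (\<Sum>k<n. \<Sum>l<n. partial_deriv i (\<lambda>x. \<psi> (inv_into U \<phi> x) k) (\<phi> q) *
                         partial_deriv j (\<lambda>x. \<psi> (inv_into U \<phi> x) l) (\<phi> q) *
                         g (V, \<psi>) (\<psi> q) k l))"

text \<open>Lebesgue (Borel) measure of the coordinate space of dimension \<open>n\<close>, carried over from the
  product measure, whose points are undefined rather than zero from index \<open>n\<close> on.\<close>

definition lborel_Rn :: "nat \<Rightarrow> (nat \<Rightarrow> real) measure" where
  "lborel_Rn n = distr (\<Pi>\<^sub>M i\<in>{..<n}. lborel) borel (\<lambda>x i. if i < n then x i else 0)"

text \<open>The Riemannian measure is the Borel measure that in each chart has the density
  \<open>\<surd>(det g)\<close> with respect to Lebesgue measure.\<close>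

definition riemannian_measure ::
  "nat \<Rightarrow> 'a::topological_space chart set \<Rightarrow>
    ('a chart \<Rightarrow> (nat \<Rightarrow> real) \<Rightarrow> nat \<Rightarrow> nat \<Rightarrow> real) \<Rightarrow> 'a measure \<Rightarrow> bool" where
  "riemannian_measure n \<A> g \<mu> \<longleftrightarrow> sets \<mu> = sets borel \<and>
     (\<forall>(U, \<phi>)\<in>\<A>. \<forall>B\<in>sets borel. B \<subseteq> U \<longrightarrow>
        emeasure \<mu> B =
          (\<integral>\<^sup>+x\<in>\<phi> ` B. ennreal (sqrt (Determinant.det (mat n n (\<lambda>(i, j). g (U, \<phi>) x i j))))
             \<partial>lborel_Rn n))"

definition invariant_measure ::
  "('g, 'z) monoid_scheme \<Rightarrow> ('g \<Rightarrow> 'a \<Rightarrow> 'a) \<Rightarrow> 'a measure \<Rightarrow> bool" where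
  "invariant_measure G act \<mu> \<longleftrightarrow>
     (\<forall>f :: 'a \<Rightarrow> real. integrable \<mu> f \<longrightarrow>
        (\<forall>\<gamma>\<in>carrier G. (\<integral>x. f (act \<gamma> x) \<partial>\<mu>) = (\<integral>x. f x \<partial>\<mu>)))"

section \<open>Conditionally positive definite kernels and kernel interpolation\<close>

text \<open>Throughout, the auxiliary functions are \<open>\<psi> 1, \<dots>, \<psi> m\<close>.\<close>

definition lin_indep :: "nat \<Rightarrow> (nat \<Rightarrow> 'a \<Rightarrow> real) \<Rightarrow> bool" where
  "lin_indep m \<psi> \<longleftrightarrow>
     (\<forall>b :: nat \<Rightarrow> real. (\<forall>x. (\<Sum>k=1..m. b k * \<psi> k x) = 0) \<longrightarrow> (\<forall>k\<in>{1..m}. b k = 0))"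

definition Pi_space :: "nat \<Rightarrow> (nat \<Rightarrow> 'a \<Rightarrow> real) \<Rightarrow> ('a \<Rightarrow> real) set" where
  "Pi_space m \<psi> = {\<lambda>x. \<Sum>k=1..m. b k * \<psi> k x | b. True}"

definition unisolvent :: "('a \<Rightarrow> real) set \<Rightarrow> 'a set \<Rightarrow> bool" where
  "unisolvent P X \<longleftrightarrow> (\<forall>p\<in>P. (\<forall>\<xi>\<in>X. p \<xi> = 0) \<longrightarrow> (\<forall>x. p x = 0))"

text \<open>Symmetry of the kernel is not part of this definition.\<close>

definition cond_pos_def :: "nat \<Rightarrow> (nat \<Rightarrow> 'a \<Rightarrow> real) \<Rightarrow> ('a \<Rightarrow> 'a \<Rightarrow> real) \<Rightarrow> bool" where
  "cond_pos_def m \<psi> \<kappa> \<longleftrightarrow>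
     (\<forall>X. finite X \<longrightarrow> unisolvent (Pi_space m \<psi>) X \<longrightarrow>
        (\<forall>a :: 'a \<Rightarrow> real. (\<exists>\<xi>\<in>X. a \<xi> \<noteq> 0) \<longrightarrow> (\<forall>k\<in>{1..m}. (\<Sum>\<xi>\<in>X. a \<xi> * \<psi> k \<xi>) = 0) \<longrightarrow>
           (\<Sum>\<xi>\<in>X. \<Sum>\<eta>\<in>X. a \<xi> * a \<eta> * \<kappa> \<xi> \<eta>) > 0))"

definition V_space ::
  "nat \<Rightarrow> (nat \<Rightarrow> 'a \<Rightarrow> real) \<Rightarrow> ('a \<Rightarrow> 'a \<Rightarrow> real) \<Rightarrow> 'a set \<Rightarrow> ('a \<Rightarrow> real) set" where
  "V_space m \<psi> \<kappa> X =
     {\<lambda>x. (\<Sum>\<xi>\<in>X. a \<xi> * \<kappa> x \<xi>) + (\<Sum>k=1..m. b k * \<psi> k x) | a b.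
        \<forall>k\<in>{1..m}. (\<Sum>\<xi>\<in>X. a \<xi> * \<psi> k \<xi>) = 0}"

definition lagrange_function ::
  "nat \<Rightarrow> (nat \<Rightarrow> 'a \<Rightarrow> real) \<Rightarrow> ('a \<Rightarrow> 'a \<Rightarrow> real) \<Rightarrow> 'a set \<Rightarrow> 'a \<Rightarrow> 'a \<Rightarrow> real" where
  "lagrange_function m \<psi> \<kappa> X \<xi> =
     (THE h. h \<in> V_space m \<psi> \<kappa> X \<and> (\<forall>\<eta>\<in>X. h \<eta> = (if \<xi> = \<eta> then 1 else 0)))"

text \<open>The block system \<open>A c + \<Psi> d = J\<^sub>0 1\<close>, \<open>\<Psi>\<^sup>T c = J\<close>. Only the entries of \<open>c\<close> on \<open>X\<close> and of
  \<open>d\<close> and \<open>J\<close> on \<open>{1..m}\<close> matter, so uniqueness is meant for these entries.\<close>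

definition solves_system ::
  "nat \<Rightarrow> (nat \<Rightarrow> 'a \<Rightarrow> real) \<Rightarrow> ('a \<Rightarrow> 'a \<Rightarrow> real) \<Rightarrow> 'a set \<Rightarrow> real \<Rightarrow> (nat \<Rightarrow> real) \<Rightarrow>
    ('a \<Rightarrow> real) \<Rightarrow> (nat \<Rightarrow> real) \<Rightarrow> bool" where
  "solves_system m \<psi> \<kappa> X J0 J c d \<longleftrightarrow>
     (\<forall>\<xi>\<in>X. (\<Sum>\<eta>\<in>X. \<kappa> \<xi> \<eta> * c \<eta>) + (\<Sum>k=1..m. \<psi> k \<xi> * d k) = J0) \<and>
     (\<forall>k\<in>{1..m}. (\<Sum>\<xi>\<in>X. \<psi> k \<xi> * c \<xi>) = J k)"

definition uniquely_solves_system ::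
  "nat \<Rightarrow> (nat \<Rightarrow> 'a \<Rightarrow> real) \<Rightarrow> ('a \<Rightarrow> 'a \<Rightarrow> real) \<Rightarrow> 'a set \<Rightarrow> real \<Rightarrow> (nat \<Rightarrow> real) \<Rightarrow>
    ('a \<Rightarrow> real) \<Rightarrow> (nat \<Rightarrow> real) \<Rightarrow> bool" where
  "uniquely_solves_system m \<psi> \<kappa> X J0 J c d \<longleftrightarrow> solves_system m \<psi> \<kappa> X J0 J c d \<and>
     (\<forall>c' d'. solves_system m \<psi> \<kappa> X J0 J c' d' \<longrightarrow>
        (\<forall>\<xi>\<in>X. c' \<xi> = c \<xi>) \<and> (\<forall>k\<in>{1..m}. d' k = d k))"

end

theory Submission
  imports Defs
begin

text \<open>Pairing \<open>s = \<Sum> a\<^sub>\<eta> \<kappa>(\<cdot>,\<eta>) + \<Sum> b\<^sub>k \<psi>\<^sub>k\<close> with \<open>c\<close> and using the symmetry of \<open>\<kappa>\<close>, the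
  first block equation turns \<open>\<Sum> c\<^sub>\<xi> s(\<xi>)\<close> into \<open>J\<^sub>0 \<Sum> a\<^sub>\<eta> + \<Sum> b\<^sub>k J\<^sub>k\<close>: the terms with \<open>d\<close>
  vanish by the side conditions on \<open>a\<close>. By invariance every \<open>\<kappa>(\<cdot>,\<eta>)\<close> has integral \<open>J\<^sub>0\<close>, so this
  is the integral of \<open>s\<close>. The Lagrange functions exist because conditional positive definiteness and
  unisolvence make the interpolation matrix injective, and \<open>s = \<chi>\<^sub>\<xi>\<close> gives the rest. Integrals of
  continuous functions are finite because the density \<open>\<surd>(det g)\<close> is locally bounded and the
  manifold is compact.\<close>

section \<open>Finiteness of the Riemannian measure\<close>

text \<open>By the Leibniz formula the determinant is a polynomial in the entries, so continuity of
  the entries suffices. Applied to the metric components, this makes the density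
  \<open>sqrt (det g)\<close> continuous in a chart.\<close>

lemma continuous_on_det:
  fixes h :: "'b::topological_space \<Rightarrow> nat \<Rightarrow> nat \<Rightarrow> real"
  assumes "\<And>i j. i < n \<Longrightarrow> j < n \<Longrightarrow> continuous_on W (\<lambda>x. h x i j)"
  shows "continuous_on W (\<lambda>x. Determinant.det (mat n n (\<lambda>(i, j). h x i j)))"
proof -
  have "Determinant.det (mat n n (\<lambda>(i, j). h x i j)) =
      (\<Sum>p | p permutes {0..<n}. signof p * (\<Prod>i = 0..<n. h x i (p i)))" for x
    using permutes_in_image[of _ "{0..<n}"]
    by (subst det_def'[where n = n]) (auto intro!: sum.cong prod.cong)
  \<comment> \<open>Entries are continuous only for indices below \<open>n\<close>; a permutation of
    \<open>{0..<n}\<close> never leaves that range.\<close>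
  moreover have "p i < n" if "p permutes {0..<n}" "i < n" for p :: "nat \<Rightarrow> nat" and i
    using that permutes_in_image[of p "{0..<n}" i] by auto
  ultimately show ?thesis
    by (auto intro!: continuous_intros assms)
qed

lemma closed_coordinate_box:
  fixes a b :: "nat \<Rightarrow> real"
  shows "closed {x. \<forall>i<n. x i \<in> {a i..b i}}"
  by (intro closed_Collect_all closed_Collect_imp open_Collect_const)
     (auto intro!: closed_Collect_conj closed_Collect_le continuous_intros)

text \<open>Pulled back along the zero-padding map that defines \<open>lborel_Rn\<close>, the
  cylinder becomes a genuine box of the finite product measure, whose measure is a finite product of
  interval lengths. For \<open>n = 0\<close> this is the empty product.\<close>

lemma emeasure_lborel_Rn_box_finite:
  "emeasure (lborel_Rn n) {x. \<forall>i<n. x i \<in> {a i..b i}} < \<infinity>"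
proof -
  let ?f = "\<lambda>x i. if i < n then x i else (0::real)"
  let ?P = "\<Pi>\<^sub>M i\<in>{..<n}. (lborel :: real measure)"
  let ?K = "{x :: nat \<Rightarrow> real. \<forall>i<n. x i \<in> {a i..b i}}"
  \<comment> \<open>Measurability is checked coordinatewise: a coordinate is a projection below
    \<open>n\<close> and the constant 0 from \<open>n\<close> on. The countable product
    sigma-algebra is then identified with the Borel sets of the function space.\<close>
  have "?f \<in> measurable ?P (\<Pi>\<^sub>M i\<in>UNIV. borel)"
  proof (rule measurable_PiM_single')
    show "(\<lambda>x. ?f x i) \<in> borel_measurable ?P" for i
      using measurable_component_singleton[of i "{..<n}" "\<lambda>_. lborel :: real measure"]
      by (cases "i < n") simp_all
  qed auto
  then have f: "?f \<in> measurable ?P borel"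
    using measurable_cong_sets[OF refl sets_PiM_equal_borel] by blast
  have "emeasure (lborel_Rn n) ?K = emeasure ?P (?f -` ?K \<inter> space ?P)"
    unfolding lborel_Rn_def by (intro emeasure_distr f borel_closed closed_coordinate_box)
  \<comment> \<open>Padding changes nothing below \<open>n\<close>, and \<open>?K\<close> leaves the
    padded coordinates free.\<close>
  also have "?f -` ?K \<inter> space ?P = Pi\<^sub>E {..<n} (\<lambda>i. {a i..b i})"
    by (rule Set.set_eqI) (simp add: space_PiM PiE_iff Ball_def conj_commute)
  also have "emeasure ?P \<dots> = (\<Prod>i<n. emeasure lborel {a i..b i})"
  proof -
    interpret product_sigma_finite "\<lambda>i::nat. lborel :: real measure"
      by unfold_locales
    show ?thesis by (rule emeasure_PiM) auto
  qed
  also have "\<dots> < \<infinity>"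
    by (simp add: ennreal_prod_eq_top less_top[symmetric] emeasure_lborel_Icc_eq)
  finally show ?thesis .
qed

text \<open>Inside one chart, shrink to an open set around \<open>q\<close> on which the density
  stays below a constant and the coordinates stay in a bounded box. The measure is then at most that
  constant times the volume of the box.\<close>

lemma riemannian_measure_locally_finite:
  fixes \<A> :: "'a::topological_space chart set"
  assumes "smooth_atlas n \<A>" "riemannian_metric n \<A> g" "riemannian_measure n \<A> g \<mu>"
  shows "\<exists>B. open B \<and> q \<in> B \<and> emeasure \<mu> B < \<infinity>"
proof -
  obtain U \<phi> where C: "(U, \<phi>) \<in> \<A>" and q: "q \<in> U"
    using assms(1) unfolding smooth_atlas_def by blast
  have U: "open U" and hom: "homeomorphism U (\<phi> ` U) \<phi> (inv_into U \<phi>)"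
    using assms(1) C unfolding smooth_atlas_def is_chart_def by auto
  have g: "continuous_on (\<phi> ` U) (\<lambda>x. g (U, \<phi>) x i j)" if "i < n" "j < n" for i j
  proof -
    have "smooth_on n (\<phi> ` U) (\<lambda>x. g (U, \<phi>) x i j)"
      using assms(2) C that unfolding riemannian_metric_def by blast
    then have "Ck_on 0 n (\<phi> ` U) (\<lambda>x. g (U, \<phi>) x i j)"
      unfolding smooth_on_def by blast
    then show ?thesis by simp
  qed
  define h where "h x = sqrt (Determinant.det (mat n n (\<lambda>(i, j). g (U, \<phi>) x i j)))" for x
  have \<phi>: "continuous_on U \<phi>"
    using hom by (simp add: homeomorphism_def)
  have h: "continuous_on (\<phi> ` U) h"
    unfolding h_def by (intro continuous_intros continuous_on_det g)
  have h\<phi>: "continuous_on U (\<lambda>x. h (\<phi> x))"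
    by (rule continuous_on_compose2[OF h \<phi>]) auto
  have \<phi>i: "continuous_on U (\<lambda>x. \<phi> x i)" for i
    using \<phi> by (rule continuous_on_product_then_coordinatewise)
  \<comment> \<open>Any bound above the density at \<open>q\<close> would do: the strict inequality
    at \<open>q\<close> makes the sublevel set an open neighbourhood of \<open>q\<close>.\<close>
  define M where "M = h (\<phi> q) + 1"
  define B where "B = {x \<in> U. h (\<phi> x) < M} \<inter> (\<Inter>i<n. {x \<in> U. \<bar>\<phi> x i - \<phi> q i\<bar> < 1}) \<inter> U"
  \<comment> \<open>A closed box containing \<open>\<phi>\<close>
    B\<open>; it is measurable and has finite volume, so it can replace\<close>\<phi>
    \<open>B\<close> in the upper estimate.\<close>
  define K where "K = {x. \<forall>i<n. x i \<in> {\<phi> q i - 1..\<phi> q i + 1}}"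
  have sub: "open {x \<in> U. f x < r}" if "continuous_on U f" for f :: "'a \<Rightarrow> real" and r
  proof -
    have "open (f -` {..<r} \<inter> U)"
      using that continuous_on_open_vimage[OF U, of f] by simp
    moreover have "f -` {..<r} \<inter> U = {x \<in> U. f x < r}" by auto
    ultimately show ?thesis by simp
  qed
  have "open B"
    unfolding B_def by (intro open_Int open_INT sub h\<phi> U ballI continuous_intros \<phi>i) auto
  moreover have "q \<in> B"
    using q by (auto simp: B_def M_def)
  moreover have "emeasure \<mu> B < \<infinity>"
  proof -
    have "B \<in> sets borel" "B \<subseteq> U"
      using \<open>open B\<close> by (auto simp: B_def)
    then have "emeasure \<mu> B = (\<integral>\<^sup>+x\<in>\<phi> ` B. ennreal (h x) \<partial>lborel_Rn n)"
      using assms(3) C unfolding riemannian_measure_def h_def by blast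
    also have "\<dots> \<le> (\<integral>\<^sup>+x\<in>K. ennreal M \<partial>lborel_Rn n)"
    proof (rule nn_integral_mono)
      fix x
      show "ennreal (h x) * indicator (\<phi> ` B) x \<le> ennreal M * indicator K x"
      proof (cases "x \<in> \<phi> ` B")
        case True
        then obtain r where r: "r \<in> B" "x = \<phi> r" by blast
        then have "h x < M" and *: "\<And>i. i < n \<Longrightarrow> \<bar>x i - \<phi> q i\<bar> < 1"
          by (simp_all add: B_def)
        moreover have "x i \<in> {\<phi> q i - 1..\<phi> q i + 1}" if "i < n" for i
          using *[OF that] by auto
        ultimately have "h x \<le> M" "x \<in> K"
          by (simp_all add: K_def)
        then show ?thesis
          using True by (simp add: ennreal_leI)
      qed simp
    qed
    also have "\<dots> \<le> ennreal M * emeasure (lborel_Rn n) K"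
    proof -
      have "K \<in> sets (lborel_Rn n)"
        unfolding K_def using closed_coordinate_box by (simp add: lborel_Rn_def borel_closed)
      then show ?thesis
        by (simp add: nn_integral_cmult_indicator)
    qed
    also have "\<dots> < \<infinity>"
      using emeasure_lborel_Rn_box_finite[of n "\<lambda>i. \<phi> q i - 1" "\<lambda>i. \<phi> q i + 1"]
      by (simp add: K_def ennreal_mult_less_top)
    finally show ?thesis .
  qed
  ultimately show ?thesis by blast
qed

text \<open>A finite subcover by open sets of finite measure and subadditivity bound the total
  mass.\<close>

lemma finite_measure_compact_locally_finite:
  fixes \<mu> :: "'a::topological_space measure"
  assumes "compact (UNIV :: 'a set)" and sets: "sets \<mu> = sets borel"
    and "\<And>q. \<exists>B. open B \<and> q \<in> B \<and> emeasure \<mu> B < \<infinity>"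
  shows "finite_measure \<mu>"
proof -
  obtain B where B: "\<And>q. open (B q)" "\<And>q. q \<in> B q" "\<And>q. emeasure \<mu> (B q) < \<infinity>"
    using assms(3) by metis
  obtain D where D: "finite D" "UNIV \<subseteq> (\<Union>q\<in>D. B q)"
  proof (rule compactE_image[OF assms(1), of UNIV B])
    show "open (B q)" for q by (rule B(1))
    show "UNIV \<subseteq> (\<Union>q\<in>UNIV. B q)" using B(2) by auto
  qed
  have "emeasure \<mu> (space \<mu>) = emeasure \<mu> (\<Union>q\<in>D. B q)"
    using D sets_eq_imp_space_eq[OF sets] by (simp add: top.extremum_unique)
  also have "\<dots> \<le> (\<Sum>q\<in>D. emeasure \<mu> (B q))"
    using B(1) D by (intro emeasure_subadditive_finite) (auto simp: sets)
  also have "\<dots> < \<infinity>"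
    using B D by (simp add: less_top)
  finally show ?thesis
    by (intro finite_measureI) simp
qed

lemma integrable_continuous_on_compact_UNIV:
  fixes f :: "'a::topological_space \<Rightarrow> real"
  assumes "compact (UNIV :: 'a set)" "finite_measure \<mu>" "sets \<mu> = sets borel"
    and "continuous_on UNIV f"
  shows "integrable \<mu> f"
proof -
  obtain b where "\<And>x. norm (f x) \<le> b"
    using compact_imp_bounded[OF compact_continuous_image[OF assms(4,1)]]
    by (auto simp: bounded_iff)
  moreover have "f \<in> borel_measurable \<mu>"
    using borel_measurable_continuous_onI[OF assms(4)] measurable_cong_sets[OF assms(3) refl]
    by blast
  ultimately show ?thesis
    using finite_measure.integrable_const_bound[OF assms(2)] by blast
qed

section \<open>Interpolation by conditionally positive definite kernels\<close>

text \<open>An injective square matrix is surjective. Stating this over an arbitrary finite index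
  set lets the interpolation system be indexed directly by nodes and basis functions; an enumeration
  of \<open>I\<close> transfers it to ordinary matrices.\<close>

lemma square_system_solvable:
  fixes M :: "'i \<Rightarrow> 'i \<Rightarrow> 'f::field"
  assumes "finite I"
    and inj: "\<And>v. \<forall>i\<in>I. (\<Sum>j\<in>I. M i j * v j) = 0 \<Longrightarrow> \<forall>j\<in>I. v j = 0"
  shows "\<exists>v. \<forall>i\<in>I. (\<Sum>j\<in>I. M i j * v j) = b i"
proof -
  define N where "N = card I"
  obtain e where e: "bij_betw e {0..<N} I"
    using ex_bij_betw_nat_finite[OF assms(1)] N_def by blast
  \<comment> \<open>\<open>r\<close> inverts the enumeration, so
    \<open>\<lambda>j. v $ (r j)\<close> reads a coordinate vector as a function on
    \<open>I\<close>.\<close>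
  define r where "r = inv_into {0..<N} e"
  have r: "r (e i) = i" if "i < N" for i
    using e that by (simp add: r_def bij_betw_inv_into_left)
  define A where "A = mat N N (\<lambda>(i, j). M (e i) (e j))"
  have A: "A \<in> carrier_mat N N" by (simp add: A_def)
  have A_mult: "(A *\<^sub>v v) $ i = (\<Sum>j\<in>I. M (e i) j * v $ (r j))"
    if "v \<in> carrier_vec N" "i < N" for v i
  proof -
    have "(A *\<^sub>v v) $ i = (\<Sum>j=0..<N. M (e i) (e j) * v $ (r (e j)))"
      using that by (simp add: A_def scalar_prod_def r)
    also have "\<dots> = (\<Sum>j\<in>I. M (e i) j * v $ (r j))"
      by (rule sum.reindex_bij_betw[OF e])
    finally show ?thesis .
  qed
  have "Determinant.det A \<noteq> 0"
  proof
    assume "Determinant.det A = 0"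
    then obtain v where v: "v \<in> carrier_vec N" "v \<noteq> 0\<^sub>v N" "A *\<^sub>v v = 0\<^sub>v N"
      using det_0_iff_vec_prod_zero_field[OF A] by blast
    have "(\<Sum>j\<in>I. M (e i) j * v $ (r j)) = 0" if "i < N" for i
      using A_mult[OF v(1) that] v(3) that by simp
    then have "\<forall>i\<in>I. (\<Sum>j\<in>I. M i j * v $ (r j)) = 0"
      using e by (auto simp: bij_betw_def)
    then have "\<forall>j\<in>I. v $ (r j) = 0" by (rule inj)
    then have "v $ j = 0" if "j < N" for j
      using r[OF that] bij_betwE[OF e] that by (metis atLeastLessThan_iff zero_le)
    then have "v = 0\<^sub>v N" using v(1) by auto
    with v(2) show False by simp
  qed
  \<comment> \<open>A nonzero determinant makes \<open>A\<close> a unit of the matrix ring;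
    \<open>()\<close> only fills the extension field of the ring record. The right inverse
    \<open>B\<close> gives the solution \<open>B *\<^sub>v w\<close>.\<close>
  from det_non_zero_imp_unit[OF A this, of "()"]
  obtain B where B: "B \<in> carrier_mat N N" "A * B = 1\<^sub>m N"
    by (auto simp: Units_def ring_mat_def)
  define w where "w = Matrix.vec N (\<lambda>i. b (e i))"
  have w: "w \<in> carrier_vec N" by (simp add: w_def)
  have Bw: "B *\<^sub>v w \<in> carrier_vec N" using B w by simp
  have "A *\<^sub>v (B *\<^sub>v w) = w"
    using assoc_mult_mat_vec[OF A B(1) w] B(2) w by simp
  then have "(\<Sum>j\<in>I. M (e i) j * (B *\<^sub>v w) $ (r j)) = b (e i)" if "i < N" for i
    using A_mult[OF Bw that] that by (simp add: w_def)
  then have "\<forall>i\<in>I. (\<Sum>j\<in>I. M i j * (B *\<^sub>v w) $ (r j)) = b i"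
    using e by (auto simp: bij_betw_def)
  then show ?thesis
    by (intro exI[of _ "\<lambda>j. (B *\<^sub>v w) $ (r j)"])
qed

text \<open>Pairing the interpolation conditions with \<open>a\<close> removes the \<psi>-part by
  the moment conditions, so the quadratic form of \<kappa> vanishes at \<open>a\<close> and
  conditional positive definiteness forces \<open>a = 0\<close> on \<open>X\<close>. What remains is
  an element of \<Pi> vanishing on \<open>X\<close>: unisolvence makes it zero everywhere, and
  linear independence then gives \<open>b = 0\<close>.\<close>

lemma interpolation_kernel_trivial:
  assumes "lin_indep m \<psi>" "cond_pos_def m \<psi> \<kappa>" "finite X" "unisolvent (Pi_space m \<psi>) X"
    and zero: "\<And>\<eta>. \<eta> \<in> X \<Longrightarrow> (\<Sum>\<xi>\<in>X. a \<xi> * \<kappa> \<eta> \<xi>) + (\<Sum>k=1..m. b k * \<psi> k \<eta>) = 0"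
    and moment: "\<And>k. k \<in> {1..m} \<Longrightarrow> (\<Sum>\<xi>\<in>X. a \<xi> * \<psi> k \<xi>) = 0"
  shows "(\<forall>\<xi>\<in>X. a \<xi> = 0) \<and> (\<forall>k\<in>{1..m}. b k = 0)"
proof -
  have "(\<Sum>\<eta>\<in>X. \<Sum>\<xi>\<in>X. a \<eta> * a \<xi> * \<kappa> \<eta> \<xi>) = (\<Sum>\<eta>\<in>X. a \<eta> * (\<Sum>\<xi>\<in>X. a \<xi> * \<kappa> \<eta> \<xi>))"
    by (simp add: sum_distrib_left mult.assoc)
  also have "\<dots> = (\<Sum>\<eta>\<in>X. - (\<Sum>k=1..m. b k * (a \<eta> * \<psi> k \<eta>)))"
  proof (rule sum.cong)
    fix \<eta> assume "\<eta> \<in> X"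
    then have "(\<Sum>\<xi>\<in>X. a \<xi> * \<kappa> \<eta> \<xi>) = - (\<Sum>k=1..m. b k * \<psi> k \<eta>)"
      using zero by (simp add: eq_neg_iff_add_eq_0)
    then show "a \<eta> * (\<Sum>\<xi>\<in>X. a \<xi> * \<kappa> \<eta> \<xi>) = - (\<Sum>k=1..m. b k * (a \<eta> * \<psi> k \<eta>))"
      by (simp add: sum_distrib_left mult.left_commute)
  qed simp
  also have "\<dots> = - (\<Sum>k=1..m. b k * (\<Sum>\<eta>\<in>X. a \<eta> * \<psi> k \<eta>))"
    unfolding sum_negf sum_distrib_left by (subst sum.swap) simp
  also have "\<dots> = 0"
    using moment by simp
  finally have energy: "(\<Sum>\<eta>\<in>X. \<Sum>\<xi>\<in>X. a \<eta> * a \<xi> * \<kappa> \<eta> \<xi>) = 0" .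
  have a: "\<forall>\<xi>\<in>X. a \<xi> = 0"
  proof (rule ccontr)
    assume "\<not> ?thesis"
    then have "\<exists>\<xi>\<in>X. a \<xi> \<noteq> 0" by blast
    moreover have "\<forall>k\<in>{1..m}. (\<Sum>\<xi>\<in>X. a \<xi> * \<psi> k \<xi>) = 0"
      using moment by (rule ballI)
    ultimately have "(\<Sum>\<eta>\<in>X. \<Sum>\<xi>\<in>X. a \<eta> * a \<xi> * \<kappa> \<eta> \<xi>) > 0"
      using assms(2)[unfolded cond_pos_def_def, rule_format, OF assms(3,4), of a] by blast
    with energy show False by simp
  qed
  then have "\<forall>\<eta>\<in>X. (\<Sum>k=1..m. b k * \<psi> k \<eta>) = 0"
    using zero by simp
  moreover have "(\<lambda>x. \<Sum>k=1..m. b k * \<psi> k x) \<in> Pi_space m \<psi>"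
    unfolding Pi_space_def by (intro CollectI exI[of _ b]) simp
  ultimately have "\<forall>x. (\<Sum>k=1..m. b k * \<psi> k x) = 0"
    using bspec[OF assms(4)[unfolded unisolvent_def], of "\<lambda>x. \<Sum>k=1..m. b k * \<psi> k x"] by simp
  then have "\<forall>k\<in>{1..m}. b k = 0"
    using spec[OF assms(1)[unfolded lin_indep_def], of b] by (rule rev_mp)
  with a show ?thesis by (rule conjI)
qed

lemma V_spaceI:
  assumes "\<And>k. k \<in> {1..m} \<Longrightarrow> (\<Sum>\<xi>\<in>X. a \<xi> * \<psi> k \<xi>) = 0"
  shows "(\<lambda>x. (\<Sum>\<xi>\<in>X. a \<xi> * \<kappa> x \<xi>) + (\<Sum>k=1..m. b k * \<psi> k x)) \<in> V_space m \<psi> \<kappa> X"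
  unfolding V_space_def
  by (rule CollectI, rule exI[of _ a], rule exI[of _ b]) (simp add: assms)

text \<open>The coefficients solve a square linear system that is injective by
  \<open>interpolation_kernel_trivial\<close>, hence solvable for every choice of data.\<close>

lemma V_space_interpolant_exists:
  assumes "lin_indep m \<psi>" "cond_pos_def m \<psi> \<kappa>" "finite X" "unisolvent (Pi_space m \<psi>) X"
  shows "\<exists>s \<in> V_space m \<psi> \<kappa> X. \<forall>\<eta>\<in>X. s \<eta> = y \<eta>"
proof -
  define M where "M i j = (case i of
      Inl \<eta> \<Rightarrow> (case j of Inl \<xi> \<Rightarrow> \<kappa> \<eta> \<xi> | Inr k \<Rightarrow> \<psi> k \<eta>)
    | Inr k \<Rightarrow> (case j of Inl \<xi> \<Rightarrow> \<psi> k \<xi> | Inr l \<Rightarrow> 0))" for i j :: "'a + nat"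
  let ?I = "X <+> {1..m}"
  have M_Inl: "(\<Sum>j\<in>?I. M (Inl \<eta>) j * v j) =
      (\<Sum>\<xi>\<in>X. v (Inl \<xi>) * \<kappa> \<eta> \<xi>) + (\<Sum>k=1..m. v (Inr k) * \<psi> k \<eta>)" for \<eta> v
    using assms(3) by (simp add: sum.Plus M_def mult.commute)
  have M_Inr: "(\<Sum>j\<in>?I. M (Inr k) j * v j) = (\<Sum>\<xi>\<in>X. v (Inl \<xi>) * \<psi> k \<xi>)" for k v
    using assms(3) by (simp add: sum.Plus M_def mult.commute)
  \<comment> \<open>The node rows prescribe the data \<open>y\<close>; the zeros in the remaining
    rows are the moment conditions required for membership in \<open>V_space\<close>.\<close>
  have "\<exists>v. \<forall>i\<in>?I. (\<Sum>j\<in>?I. M i j * v j) = case_sum y (\<lambda>k. 0) i"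
  proof (rule square_system_solvable)
    fix v assume v: "\<forall>i\<in>?I. (\<Sum>j\<in>?I. M i j * v j) = 0"
    have "(\<forall>\<xi>\<in>X. v (Inl \<xi>) = 0) \<and> (\<forall>k\<in>{1..m}. v (Inr k) = 0)"
    proof (rule interpolation_kernel_trivial[OF assms])
      show "(\<Sum>\<xi>\<in>X. v (Inl \<xi>) * \<kappa> \<eta> \<xi>) + (\<Sum>k=1..m. v (Inr k) * \<psi> k \<eta>) = 0"
        if "\<eta> \<in> X" for \<eta>
        using bspec[OF v, of "Inl \<eta>"] that unfolding M_Inl by blast
      show "(\<Sum>\<xi>\<in>X. v (Inl \<xi>) * \<psi> k \<xi>) = 0" if "k \<in> {1..m}" for k
        using bspec[OF v, of "Inr k"] that unfolding M_Inr by blast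
    qed
    then show "\<forall>j\<in>?I. v j = 0" by blast
  qed (use assms(3) in simp)
  then obtain v where v: "\<And>i. i \<in> ?I \<Longrightarrow> (\<Sum>j\<in>?I. M i j * v j) = case_sum y (\<lambda>k. 0) i"
    by blast
  let ?s = "\<lambda>x. (\<Sum>\<xi>\<in>X. v (Inl \<xi>) * \<kappa> x \<xi>) + (\<Sum>k=1..m. v (Inr k) * \<psi> k x)"
  have "?s \<in> V_space m \<psi> \<kappa> X"
    by (rule V_spaceI) (use v[OF InrI] in \<open>unfold M_Inr, simp\<close>)
  moreover have "\<forall>\<eta>\<in>X. ?s \<eta> = y \<eta>"
    using v[OF InlI] unfolding M_Inl by simp
  ultimately show ?thesis by (rule bexI[of _ ?s, rotated])
qed

text \<open>The differences of the coefficients satisfy the homogeneous system, so they vanish.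
  Hence agreement on \<open>X\<close> gives equality of functions on the whole space.\<close>

lemma V_space_interpolant_unique:
  assumes "lin_indep m \<psi>" "cond_pos_def m \<psi> \<kappa>" "finite X" "unisolvent (Pi_space m \<psi>) X"
    and "s \<in> V_space m \<psi> \<kappa> X" "t \<in> V_space m \<psi> \<kappa> X" "\<And>\<eta>. \<eta> \<in> X \<Longrightarrow> s \<eta> = t \<eta>"
  shows "s = t"
proof -
  obtain a b where s: "s = (\<lambda>x. (\<Sum>\<xi>\<in>X. a \<xi> * \<kappa> x \<xi>) + (\<Sum>k=1..m. b k * \<psi> k x))"
    and a: "\<And>k. k \<in> {1..m} \<Longrightarrow> (\<Sum>\<xi>\<in>X. a \<xi> * \<psi> k \<xi>) = 0"
    using assms(5) unfolding V_space_def by blast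
  obtain a' b' where t: "t = (\<lambda>x. (\<Sum>\<xi>\<in>X. a' \<xi> * \<kappa> x \<xi>) + (\<Sum>k=1..m. b' k * \<psi> k x))"
    and a': "\<And>k. k \<in> {1..m} \<Longrightarrow> (\<Sum>\<xi>\<in>X. a' \<xi> * \<psi> k \<xi>) = 0"
    using assms(6) unfolding V_space_def by blast
  have "(\<forall>\<xi>\<in>X. a \<xi> - a' \<xi> = 0) \<and> (\<forall>k\<in>{1..m}. b k - b' k = 0)"
  proof (rule interpolation_kernel_trivial[OF assms(1-4)])
    show "(\<Sum>\<xi>\<in>X. (a \<xi> - a' \<xi>) * \<kappa> \<eta> \<xi>) + (\<Sum>k=1..m. (b k - b' k) * \<psi> k \<eta>) = 0"
      if "\<eta> \<in> X" for \<eta>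
      using assms(7)[OF that] by (simp add: s t left_diff_distrib sum_subtractf)
    show "(\<Sum>\<xi>\<in>X. (a \<xi> - a' \<xi>) * \<psi> k \<xi>) = 0" if "k \<in> {1..m}" for k
      using a[OF that] a'[OF that] by (simp add: left_diff_distrib sum_subtractf)
  qed
  then show ?thesis
    unfolding s t by (intro ext arg_cong2[where f = "(+)"] sum.cong) auto
qed

text \<open>Existence and uniqueness of the interpolant of Kronecker data give the definite
  description in \<open>lagrange_function\<close> its intended value.\<close>

lemma lagrange_function_in_V_space:
  assumes "lin_indep m \<psi>" "cond_pos_def m \<psi> \<kappa>" "finite X" "unisolvent (Pi_space m \<psi>) X"
  shows "lagrange_function m \<psi> \<kappa> X \<xi> \<in> V_space m \<psi> \<kappa> X"
    and "\<And>\<eta>. \<eta> \<in> X \<Longrightarrow> lagrange_function m \<psi> \<kappa> X \<xi> \<eta> = (if \<xi> = \<eta> then 1 else 0)"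
proof -
  let ?L = "\<lambda>h. h \<in> V_space m \<psi> \<kappa> X \<and> (\<forall>\<eta>\<in>X. h \<eta> = (if \<xi> = \<eta> then 1 else 0))"
  have "\<exists>!h. ?L h"
  proof (rule ex_ex1I)
    show "\<exists>h. ?L h"
      using V_space_interpolant_exists[OF assms, of "\<lambda>\<eta>. if \<xi> = \<eta> then 1 else 0"] by blast
    show "h = h'" if "?L h" "?L h'" for h h'
      by (rule V_space_interpolant_unique[OF assms]) (use that in auto)
  qed
  then have "?L (lagrange_function m \<psi> \<kappa> X \<xi>)"
    unfolding lagrange_function_def by (rule theI')
  then show "lagrange_function m \<psi> \<kappa> X \<xi> \<in> V_space m \<psi> \<kappa> X"
    and "\<And>\<eta>. \<eta> \<in> X \<Longrightarrow> lagrange_function m \<psi> \<kappa> X \<xi> \<eta> = (if \<xi> = \<eta> then 1 else 0)"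
    by auto
qed

section \<open>Quadrature weights\<close>

text \<open>A group element carrying \<open>z\<close> to \<open>y\<close> turns one integral into
  the other: translate the integration variable by invariance of \<mu>, then cancel the group
  element from both arguments of \<kappa>.\<close>

lemma integral_invariant_kernel_const:
  fixes \<kappa> :: "'a \<Rightarrow> 'a \<Rightarrow> real"
  assumes "transitive_action G UNIV act" "invariant_measure G act \<mu>"
    and "integrable \<mu> (\<lambda>x. \<kappa> x y)"
    and "\<And>\<gamma> x y. \<gamma> \<in> carrier G \<Longrightarrow> \<kappa> (act \<gamma> x) (act \<gamma> y) = \<kappa> x y"
  shows "(\<integral>x. \<kappa> x y \<partial>\<mu>) = (\<integral>x. \<kappa> x z \<partial>\<mu>)"
proof -
  obtain \<gamma> where \<gamma>: "\<gamma> \<in> carrier G" "act \<gamma> z = y"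
    using transitive_action.unique_orbit[OF assms(1), of z y] by auto
  have "(\<integral>x. \<kappa> x y \<partial>\<mu>) = (\<integral>x. \<kappa> (act \<gamma> x) y \<partial>\<mu>)"
    using assms(2)[unfolded invariant_measure_def, rule_format, OF assms(3) \<gamma>(1)] by (rule sym)
  also have "\<dots> = (\<integral>x. \<kappa> x z \<partial>\<mu>)"
    using assms(4)[OF \<gamma>(1)] \<gamma>(2) by metis
  finally show ?thesis .
qed

text \<open>The algebraic half of the quadrature formula, free of integrals: its right side is what
  integrating the expansion term by term produces once \<open>J0\<close> and \<open>J\<close> are
  the respective integrals.\<close>

lemma weighted_sum_V_space:
  assumes "solves_system m \<psi> \<kappa> X J0 J c d" "\<And>x y. \<kappa> x y = \<kappa> y x"
    and "\<And>k. k \<in> {1..m} \<Longrightarrow> (\<Sum>\<xi>\<in>X. a \<xi> * \<psi> k \<xi>) = 0"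
  shows "(\<Sum>\<xi>\<in>X. c \<xi> * ((\<Sum>\<eta>\<in>X. a \<eta> * \<kappa> \<xi> \<eta>) + (\<Sum>k=1..m. b k * \<psi> k \<xi>))) =
    (\<Sum>\<eta>\<in>X. a \<eta> * J0) + (\<Sum>k=1..m. b k * J k)"
proof -
  \<comment> \<open>Exchanging the sums leaves the transpose of the kernel matrix acting on
    \<open>c\<close>; symmetry of \<kappa> turns it into a row of \<open>A c\<close>, to which the
    first block equation applies.\<close>
  have "(\<Sum>\<xi>\<in>X. c \<xi> * (\<Sum>\<eta>\<in>X. a \<eta> * \<kappa> \<xi> \<eta>)) = (\<Sum>\<eta>\<in>X. a \<eta> * (\<Sum>\<xi>\<in>X. \<kappa> \<eta> \<xi> * c \<xi>))"
    unfolding sum_distrib_left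
    by (subst sum.swap) (simp add: assms(2) mult_ac)
  also have "\<dots> = (\<Sum>\<eta>\<in>X. a \<eta> * J0 - (\<Sum>k=1..m. d k * (a \<eta> * \<psi> k \<eta>)))"
  proof (rule sum.cong)
    fix \<eta> assume "\<eta> \<in> X"
    then have "(\<Sum>\<xi>\<in>X. \<kappa> \<eta> \<xi> * c \<xi>) = J0 - (\<Sum>k=1..m. \<psi> k \<eta> * d k)"
      using assms(1) by (simp add: solves_system_def eq_diff_eq)
    then show "a \<eta> * (\<Sum>\<xi>\<in>X. \<kappa> \<eta> \<xi> * c \<xi>) = a \<eta> * J0 - (\<Sum>k=1..m. d k * (a \<eta> * \<psi> k \<eta>))"
      by (simp add: right_diff_distrib sum_distrib_left mult_ac)
  qed simp
  also have "\<dots> = (\<Sum>\<eta>\<in>X. a \<eta> * J0) - (\<Sum>k=1..m. d k * (\<Sum>\<eta>\<in>X. a \<eta> * \<psi> k \<eta>))"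
    unfolding sum_subtractf sum_distrib_left by (subst sum.swap) simp
  also have "\<dots> = (\<Sum>\<eta>\<in>X. a \<eta> * J0)"
    using assms(3) by simp
  finally have 1: "(\<Sum>\<xi>\<in>X. c \<xi> * (\<Sum>\<eta>\<in>X. a \<eta> * \<kappa> \<xi> \<eta>)) = (\<Sum>\<eta>\<in>X. a \<eta> * J0)" .
  \<comment> \<open>For the \<psi>-part the exchange produces exactly the second block
    equation.\<close>
  have "(\<Sum>\<xi>\<in>X. c \<xi> * (\<Sum>k=1..m. b k * \<psi> k \<xi>)) = (\<Sum>k=1..m. b k * (\<Sum>\<xi>\<in>X. \<psi> k \<xi> * c \<xi>))"
    unfolding sum_distrib_left by (subst sum.swap) (simp add: mult_ac)
  also have "\<dots> = (\<Sum>k=1..m. b k * J k)"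
    using assms(1) by (simp add: solves_system_def)
  finally show ?thesis
    using 1 by (simp add: distrib_left sum.distrib)
qed

theorem proposition2p2:
  fixes G :: "'g::{t2_space, second_countable_topology} monoid"
    and \<B> :: "'g chart set" and p :: nat
    and \<A> :: "'a::{t2_space, second_countable_topology} chart set" and n :: nat
    and g :: "'a chart \<Rightarrow> (nat \<Rightarrow> real) \<Rightarrow> nat \<Rightarrow> nat \<Rightarrow> real"
    and act :: "'g \<Rightarrow> 'a \<Rightarrow> 'a"
    and \<mu> :: "'a measure"
    and m :: nat and \<psi> :: "nat \<Rightarrow> 'a \<Rightarrow> real"
    and \<kappa> :: "'a \<Rightarrow> 'a \<Rightarrow> real"
    and X :: "'a set" and y0 :: 'a
    and J0 :: real and J :: "nat \<Rightarrow> real"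
    and c :: "'a \<Rightarrow> real" and d :: "nat \<Rightarrow> real"
  assumes "compact (UNIV :: 'a set)"
    and "homogeneous_space p \<B> G n \<A> act"
    and "riemannian_metric n \<A> g"
    and "riemannian_measure n \<A> g \<mu>"
    and "invariant_measure G act \<mu>"
    and "\<And>k. k \<in> {1..m} \<Longrightarrow> continuous_on UNIV (\<psi> k)"
    and "lin_indep m \<psi>"
    and "continuous_on UNIV (\<lambda>(x, y). \<kappa> x y)"
    and "\<And>x y. \<kappa> x y = \<kappa> y x"
    and "cond_pos_def m \<psi> \<kappa>"
    and "\<And>\<gamma> x y. \<gamma> \<in> carrier G \<Longrightarrow> \<kappa> (act \<gamma> x) (act \<gamma> y) = \<kappa> x y"
    and "finite X"
    and "unisolvent (Pi_space m \<psi>) X"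
    and "J0 = (\<integral>x. \<kappa> x y0 \<partial>\<mu>)"
    and "\<And>k. k \<in> {1..m} \<Longrightarrow> J k = (\<integral>x. \<psi> k x \<partial>\<mu>)"
    and "uniquely_solves_system m \<psi> \<kappa> X J0 J c d"
  shows "(\<forall>y. (\<integral>x. \<kappa> x y \<partial>\<mu>) = J0) \<and>
    (\<forall>s \<in> V_space m \<psi> \<kappa> X. (\<integral>x. s x \<partial>\<mu>) = (\<Sum>\<xi>\<in>X. c \<xi> * s \<xi>)) \<and>
    (\<forall>\<xi>\<in>X. c \<xi> = (\<integral>x. lagrange_function m \<psi> \<kappa> X \<xi> x \<partial>\<mu>) \<and>
            \<bar>c \<xi>\<bar> \<le> (\<integral>x. \<bar>lagrange_function m \<psi> \<kappa> X \<xi> x\<bar> \<partial>\<mu>))"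
proof -
  have act: "transitive_action G UNIV act" and atlas: "smooth_atlas n \<A>"
    using assms(2) by (auto simp: homogeneous_space_def)
  have sets: "sets \<mu> = sets borel"
    using assms(4) by (simp add: riemannian_measure_def)
  have fin: "finite_measure \<mu>"
    using finite_measure_compact_locally_finite[OF assms(1) sets]
      riemannian_measure_locally_finite[OF atlas assms(3,4)] by blast
  note int = integrable_continuous_on_compact_UNIV[OF assms(1) fin sets]
  \<comment> \<open>Joint continuity of \<kappa> is restricted to a slice by composing with
    \<open>\<lambda>x. (x, y)\<close>.\<close>
  have int_\<kappa>: "integrable \<mu> (\<lambda>x. \<kappa> x y)" for y
  proof (rule int)
    have "continuous_on UNIV (\<lambda>x. (\<lambda>(x, y). \<kappa> x y) (x, y))"
      by (rule continuous_on_compose2[OF assms(8)]) (auto intro!: continuous_intros)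
    then show "continuous_on UNIV (\<lambda>x. \<kappa> x y)" by simp
  qed
  have int_\<psi>: "integrable \<mu> (\<psi> k)" if "k \<in> {1..m}" for k
    using int assms(6)[OF that] by blast
  \<comment> \<open>\<open>J0\<close> is defined through the base point \<open>y0\<close>;
    transitivity extends its value to every \<open>y\<close>.\<close>
  have J0: "(\<integral>x. \<kappa> x y \<partial>\<mu>) = J0" for y
    unfolding assms(14)
    by (rule integral_invariant_kernel_const[where \<kappa> = \<kappa>, OF act assms(5) int_\<kappa> assms(11)])
  have solves: "solves_system m \<psi> \<kappa> X J0 J c d"
    using assms(16) unfolding uniquely_solves_system_def by (rule conjunct1)
  have quad: "(\<integral>x. s x \<partial>\<mu>) = (\<Sum>\<xi>\<in>X. c \<xi> * s \<xi>)" if "s \<in> V_space m \<psi> \<kappa> X" for s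
  proof -
    obtain a b where s: "s = (\<lambda>x. (\<Sum>\<xi>\<in>X. a \<xi> * \<kappa> x \<xi>) + (\<Sum>k=1..m. b k * \<psi> k x))"
      and a: "\<And>k. k \<in> {1..m} \<Longrightarrow> (\<Sum>\<xi>\<in>X. a \<xi> * \<psi> k \<xi>) = 0"
      using \<open>s \<in> V_space m \<psi> \<kappa> X\<close> unfolding V_space_def by blast
    have int_a: "integrable \<mu> (\<lambda>x. \<Sum>\<xi>\<in>X. a \<xi> * \<kappa> x \<xi>)"
      by (rule Bochner_Integration.integrable_sum) (rule integrable_mult_right[OF int_\<kappa>])
    have int_b: "integrable \<mu> (\<lambda>x. \<Sum>k=1..m. b k * \<psi> k x)"
      by (rule Bochner_Integration.integrable_sum) (rule integrable_mult_right[OF int_\<psi>])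
    have "(\<integral>x. s x \<partial>\<mu>) =
        (\<integral>x. (\<Sum>\<xi>\<in>X. a \<xi> * \<kappa> x \<xi>) \<partial>\<mu>) + (\<integral>x. (\<Sum>k=1..m. b k * \<psi> k x) \<partial>\<mu>)"
      unfolding s by (rule Bochner_Integration.integral_add[OF int_a int_b])
    also have "(\<integral>x. (\<Sum>\<xi>\<in>X. a \<xi> * \<kappa> x \<xi>) \<partial>\<mu>) = (\<Sum>\<xi>\<in>X. a \<xi> * J0)"
      by (subst Bochner_Integration.integral_sum) (auto simp: int_\<kappa> J0)
    also have "(\<integral>x. (\<Sum>k=1..m. b k * \<psi> k x) \<partial>\<mu>) = (\<Sum>k=1..m. b k * J k)"
      by (subst Bochner_Integration.integral_sum) (auto simp: int_\<psi> assms(15))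
    also have "(\<Sum>\<xi>\<in>X. a \<xi> * J0) + (\<Sum>k=1..m. b k * J k) = (\<Sum>\<xi>\<in>X. c \<xi> * s \<xi>)"
      unfolding s
      by (rule weighted_sum_V_space[where a = a and b = b, OF solves assms(9) a, symmetric])
    finally show ?thesis .
  qed
  have "c \<xi> = (\<integral>x. lagrange_function m \<psi> \<kappa> X \<xi> x \<partial>\<mu>) \<and>
      \<bar>c \<xi>\<bar> \<le> (\<integral>x. \<bar>lagrange_function m \<psi> \<kappa> X \<xi> x\<bar> \<partial>\<mu>)" if "\<xi> \<in> X" for \<xi>
  proof -
    note L = lagrange_function_in_V_space[OF assms(7,10,12,13), where \<xi> = \<xi>]
    \<comment> \<open>The quadrature formula is applied to the Lagrange function, whose Kronecker
      values on \<open>X\<close> single out one weight. The bound on that weight is then the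
      triangle inequality for integrals.\<close>
    have "(\<integral>x. lagrange_function m \<psi> \<kappa> X \<xi> x \<partial>\<mu>) = (\<Sum>\<eta>\<in>X. if \<xi> = \<eta> then c \<eta> else 0)"
      unfolding quad[OF L(1)] by (intro sum.cong) (auto simp: L(2))
    also have "\<dots> = c \<xi>"
      using that assms(12) by simp
    finally show ?thesis
      using integral_abs_bound[of \<mu> "lagrange_function m \<psi> \<kappa> X \<xi>"] by simp
  qed
  with J0 quad show ?thesis by (intro conjI allI ballI) simp_all
qed

end
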